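(* Let $p\ge 1$, let $H\in\mathbb{R}^{p\times p}$ be symmetric positive definite with $H_{ii}=1$ for all $i$, let $a\in\mathbb{R}^p$, $r_i>0$ for $i=1,\dots,p$, and let $f(x)=\tfrac12 x^\top Hx-a^\top x$ on the box $\mathcal{B}=\prod_{i=1}^p[0,r_i]$. With $T$ the strictly lower triangular part of $H$ and $\chi_*$ the worst-case one-sweep objective contraction of exact cyclic coordinate minimization (see context), set $$A_0=\lambda_{\max}(TH^{-1}T^\top).$$ Then $$\chi_*\le\frac{A_0}{1+A_0}.$$ If the unique minimizer $x_*$ of $f$ over $\mathcal{B}$ lies in the interior of $\mathcal{B}$, then equality holds: $\chi_*=\frac{A_0}{1+A_0}$.
   Context: $\lambda_{\max}$ is the largest eigenvalue of a symmetric matrix. $X_*=\arg\min_{x\in\mathcal{B}}f(x)$, $f_*=\min_{x\in\mathcal{B}}f(x)$, $\Delta(x)=f(x)-f_*$, and $g(x)=Hx-a$ is the gradient of $f$. Cyclic sweep: given $x\in\mathcal{B}$, put $x^0=x$; for $i=1,\dots,p$, $x^i$ agrees with $x^{i-1}$ except in coordinate $i$, where $x^i_i=\min\{r_i,\max\{0,\,x^{i-1}_i-g_i(x^{i-1})\}\}$ (the exact minimizer of $f$ in coordinate $i$ over $[0,r_i]$, since $H_{ii}=1$). Then $\mathcal{C}(x):=x^p$. The worst-case one-sweep objective contraction is $$\chi_*:=\sup_{x\in\mathcal{B}\setminus X_*}\frac{\Delta(\mathcal{C}(x))}{\Delta(x)}.$$ $T$ is the strictly lower triangular part of $H$: $T_{ij}=H_{ij}$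 for $i>j$ and $T_{ij}=0$ for $i\le j$, so $H=I+T+T^\top$. *)

theory Defs
  imports "HOL-Analysis.Analysis"
begin

(* Coordinates are indexed by a finite linearly ordered type 'n; its order plays the role of
   1 < 2 < ... < p with p = CARD('n). *)

definition pos_def :: "real ^ 'n ^ 'n \<Rightarrow> bool" where
  "pos_def H \<longleftrightarrow> transpose H = H \<and> (\<forall>x. x \<noteq> 0 \<longrightarrow> x \<bullet> (H *v x) > 0)"

definition eigenvalue :: "real ^ 'n ^ 'n \<Rightarrow> real \<Rightarrow> bool" where
  "eigenvalue A k \<longleftrightarrow> (\<exists>v. v \<noteq> 0 \<and> A *v v = k *\<^sub>R v)"

(* Intended for symmetric A, whose set of real eigenvalues is finite and nonempty. *)
definition lambda_max :: "real ^ 'n ^ 'n \<Rightarrow> real" where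
  "lambda_max A = Max {k. eigenvalue A k}"

definition strict_lower ::
    "real ^ 'n::{finite,linorder} ^ 'n::{finite,linorder} \<Rightarrow>
     real ^ 'n::{finite,linorder} ^ 'n::{finite,linorder}" where
  "strict_lower H = (\<chi> i j. if j < i then H $ i $ j else 0)"

definition obj :: "real ^ 'n ^ 'n \<Rightarrow> real ^ 'n \<Rightarrow> real ^ 'n \<Rightarrow> real" where
  "obj H a x = 1 / 2 * (x \<bullet> (H *v x)) - a \<bullet> x"

definition obj_grad :: "real ^ 'n ^ 'n \<Rightarrow> real ^ 'n \<Rightarrow> real ^ 'n \<Rightarrow> real ^ 'n" where
  "obj_grad H a x = H *v x - a"

abbreviation box_dom :: "real ^ 'n \<Rightarrow> (real ^ 'n) set" where
  "box_dom r \<equiv> cbox 0 r"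

definition minimizers :: "real ^ 'n ^ 'n \<Rightarrow> real ^ 'n \<Rightarrow> real ^ 'n \<Rightarrow> (real ^ 'n) set" where
  "minimizers H a r = {x. is_arg_min (obj H a) (\<lambda>y. y \<in> box_dom r) x}"

(* The infimum is attained, as the box is compact. *)
definition obj_min :: "real ^ 'n ^ 'n \<Rightarrow> real ^ 'n \<Rightarrow> real ^ 'n \<Rightarrow> real" where
  "obj_min H a r = (INF x\<in>box_dom r. obj H a x)"

definition gap :: "real ^ 'n ^ 'n \<Rightarrow> real ^ 'n \<Rightarrow> real ^ 'n \<Rightarrow> real ^ 'n \<Rightarrow> real" where
  "gap H a r x = obj H a x - obj_min H a r"

definition coord_step ::
    "real ^ 'n ^ 'n \<Rightarrow> real ^ 'n \<Rightarrow> real ^ 'n \<Rightarrow> 'n \<Rightarrow> real ^ 'n \<Rightarrow> real ^ 'n" where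
  "coord_step H a r i x =
     (\<chi> j. if j = i then min (r $ i) (max 0 (x $ i - obj_grad H a x $ i)) else x $ j)"

(* fold processes the list from its head, so coordinates are updated in increasing order. *)
definition sweep ::
    "real ^ 'n::{finite,linorder} ^ 'n::{finite,linorder} \<Rightarrow>
     real ^ 'n::{finite,linorder} \<Rightarrow>
     real ^ 'n::{finite,linorder} \<Rightarrow>
     real ^ 'n::{finite,linorder} \<Rightarrow>
     real ^ 'n::{finite,linorder}" where
  "sweep H a r x = fold (coord_step H a r) (sorted_list_of_set UNIV) x"

(* A supremum of reals: for the problems considered the index set is nonempty, and the quotients
   lie in [0,1] because a sweep never increases the objective. *)
definition contraction ::
    "real ^ 'n::{finite,linorder} ^ 'n::{finite,linorder} \<Rightarrow>
     real ^ 'n::{finite,linorder} \<Rightarrow>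
     real ^ 'n::{finite,linorder} \<Rightarrow>
     real" where
  "contraction H a r =
     (SUP x\<in>box_dom r - minimizers H a r. gap H a r (sweep H a r x) / gap H a r x)"

end

theory Submission
  imports Defs
begin

text \<open>
  Let \<open>y\<close> be the result of a sweep from \<open>x\<close>, \<open>d = y - x\<close> and \<open>q = g(y) - T\<^sup>T d\<close>. The component
  \<open>q\<^sub>i\<close> is the partial derivative seen by the \<open>i\<close>-th step after its update, so exact minimization
  gives \<open>q \<bullet> (z - y) \<ge> 0\<close> for every \<open>z\<close> in the box. Expanding \<open>f\<close> around \<open>y\<close> yields
  \<open>f(x) - f(y) = |d|\<^sup>2/2 + q \<bullet> (x - y) \<ge> |d|\<^sup>2/2\<close>, and completing the square in
  \<open>f(y) - f(z) \<le> - (T\<^sup>T d) \<bullet> (z - y) - (z - y) \<bullet> H (z - y)/2\<close> yields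
  \<open>f(y) - f(z) \<le> d \<bullet> T H\<^sup>-\<^sup>1 T\<^sup>T d/2 \<le> A\<^sub>0 |d|\<^sup>2/2\<close>. The two bounds combine to the claimed contraction.
  If the minimizer is interior, all inequalities become equalities for a small multiple \<open>d\<close> of a top
  eigenvector of \<open>T H\<^sup>-\<^sup>1 T\<^sup>T\<close> and \<open>y = x\<^sub>* + H\<^sup>-\<^sup>1 T\<^sup>T d\<close>, \<open>x = y - d\<close>, since then \<open>q = 0\<close>.
\<close>

section \<open>Largest eigenvalue of a symmetric matrix\<close>

lemma symmetric_inner:
  fixes A :: "real^'n^'n"
  assumes "transpose A = A"
  shows "x \<bullet> (A *v y) = (A *v x) \<bullet> y"
  by (metis assms dot_lmul_matrix transpose_matrix_vector)

text \<open>Divide by \<open>t\<close> and let \<open>t\<close> tend to 0. This is the first-order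
  condition, used both for the Rayleigh quotient and for interior minimizers.\<close>

lemma linear_coeff_nonpos:
  fixes b c e :: real
  assumes "e > 0" and le: "\<And>t. 0 < t \<Longrightarrow> t < e \<Longrightarrow> t * b \<le> t\<^sup>2 * c"
  shows "b \<le> 0"
proof (rule ccontr)
  assume "\<not> b \<le> 0"
  then have b: "b > 0" by simp
  \<comment> \<open>The second argument makes \<open>t * c\<close> at most \<open>b / 2\<close>,
    contradicting \<open>b <= t * c\<close>.\<close>
  define t where "t = min (e/2) (b / (2 * (\<bar>c\<bar> + 1)))"
  have "t \<le> e/2" unfolding t_def by (rule min.cobounded1)
  then have t: "0 < t" "t < e"
    using \<open>e > 0\<close> b by (simp_all add: t_def add_nonneg_pos)
  have "t * b \<le> t * (t * c)" using le[OF t] by (simp add: power2_eq_square mult.assoc)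
  then have "b \<le> t * c" using t by simp
  also have "\<dots> \<le> t * (\<bar>c\<bar> + 1)" using t by (intro mult_left_mono) auto
  also have "\<dots> \<le> b / (2 * (\<bar>c\<bar> + 1)) * (\<bar>c\<bar> + 1)"
    by (intro mult_right_mono) (auto simp: t_def)
  also have "\<dots> = b / 2"
  proof -
    have "\<bar>c\<bar> + 1 \<noteq> 0" by linarith
    then show ?thesis by (simp add: field_simps)
  qed
  finally show False using b by simp
qed

text \<open>Eigenvectors of a symmetric matrix for distinct eigenvalues are orthogonal, hence
  independent. Finiteness gives the \<open>Max\<close> in \<open>lambda_max\<close> its
  meaning.\<close>

lemma finite_eigenvalues:
  fixes A :: "real^'n^'n"
  assumes "transpose A = A"
  shows "finite {k. eigenvalue A k}"
proof -
  define v where "v k = (SOME v. v \<noteq> 0 \<and> A *v v = k *\<^sub>R v)" for k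
  have v: "v k \<noteq> 0 \<and> A *v v k = k *\<^sub>R v k" if "eigenvalue A k" for k
    using someI_ex[OF that[unfolded eigenvalue_def]] unfolding v_def .
  have orth: "v k \<bullet> v l = 0" if "eigenvalue A k" "eigenvalue A l" "k \<noteq> l" for k l
    using symmetric_inner[OF assms, of "v k" "v l"] v[OF that(1)] v[OF that(2)] that(3) by simp
  have inj: "inj_on v {k. eigenvalue A k}"
    by (metis (mono_tags, lifting) inj_onI inner_eq_zero_iff mem_Collect_eq orth v)
  have "pairwise orthogonal (v ` {k. eigenvalue A k})"
    by (auto simp: pairwise_def orthogonal_def intro: orth)
  moreover have "0 \<notin> v ` {k. eigenvalue A k}" using v by force
  ultimately have "independent (v ` {k. eigenvalue A k})"
    by (rule pairwise_orthogonal_independent)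
  then show ?thesis
    using inj finite_imageD independent_imp_finite by blast
qed

text \<open>The Rayleigh quotient attains its maximum \<open>K\<close> on the compact unit sphere,
  and stationarity makes the maximizer an eigenvector.\<close>

lemma lambda_max_symmetric:
  fixes A :: "real^'n^'n"
  assumes sym: "transpose A = A"
  shows "eigenvalue A (lambda_max A)" and "x \<bullet> (A *v x) \<le> lambda_max A * (x \<bullet> x)"
proof -
  have "continuous_on (sphere 0 1) (\<lambda>x::real^'n. x \<bullet> (A *v x))"
    by (intro continuous_intros linear_continuous_on matrix_vector_mul_bounded_linear)
  moreover have "sphere (0::real^'n) 1 \<noteq> {}" by simp
  ultimately obtain v :: "real^'n" where v: "norm v = 1"
    and max: "\<And>x. norm x = 1 \<Longrightarrow> x \<bullet> (A *v x) \<le> v \<bullet> (A *v v)"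
    using continuous_attains_sup[of "sphere (0::real^'n) 1" "\<lambda>x. x \<bullet> (A *v x)"] by auto
  define K where "K = v \<bullet> (A *v v)"
  have bound: "x \<bullet> (A *v x) \<le> K * (x \<bullet> x)" for x
  proof (cases "x = 0")
    case False
    have "(x /\<^sub>R norm x) \<bullet> (A *v (x /\<^sub>R norm x)) \<le> K"
      unfolding K_def using False by (intro max) simp
    then show ?thesis
      using False by (simp add: matrix_vector_mult_scaleR field_simps dot_square_norm power2_eq_square)
  qed simp
  \<comment> \<open>The residual of the eigenvector equation is itself the test direction: along
    \<open>v + t *\<^sub>R u\<close> the nonnegative form
    \<open>K * (x \<bullet> x) - x \<bullet> (A *v x)\<close> has linear term
    \<open>- 2 * t * (u \<bullet> u)\<close>, so \<open>u = 0\<close>.\<close>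
  define u where "u = A *v v - K *\<^sub>R v"
  define c where "c = K * (u \<bullet> u) - u \<bullet> (A *v u)"
  have "2 * (u \<bullet> u) \<le> 0"
  proof (rule linear_coeff_nonpos[of 1 _ c])
    fix t :: real
    have "0 \<le> K * ((v + t *\<^sub>R u) \<bullet> (v + t *\<^sub>R u)) - (v + t *\<^sub>R u) \<bullet> (A *v (v + t *\<^sub>R u))"
      using bound[of "v + t *\<^sub>R u"] by simp
    also have "\<dots> = K * (v \<bullet> v) - v \<bullet> (A *v v) + 2 * t * (K * (v \<bullet> u) - (A *v v) \<bullet> u) + t\<^sup>2 * c"
      using symmetric_inner[OF sym, of v u]
      by (simp add: c_def matrix_vector_right_distrib matrix_vector_mult_scaleR inner_add_left inner_add_right
          inner_commute power2_eq_square algebra_simps)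
    also have "K * (v \<bullet> v) - v \<bullet> (A *v v) = 0"
      using v by (simp add: K_def dot_square_norm)
    also have "K * (v \<bullet> u) - (A *v v) \<bullet> u = - (u \<bullet> u)"
      by (simp add: u_def inner_diff_left inner_diff_right algebra_simps)
    finally show "t * (2 * (u \<bullet> u)) \<le> t\<^sup>2 * c" by simp
  qed simp
  then have "u = 0" using inner_ge_zero[of u] by simp
  then have ev: "eigenvalue A K"
    unfolding eigenvalue_def u_def using v by (intro exI[of _ v]) auto
  have "k \<le> K" if "eigenvalue A k" for k
  proof -
    from that obtain w where w: "w \<noteq> 0" "A *v w = k *\<^sub>R w" by (auto simp: eigenvalue_def)
    then show ?thesis using bound[of w] by simp
  qed
  then have "lambda_max A = K"
    unfolding lambda_max_def using ev finite_eigenvalues[OF sym] by (intro Max_eqI) auto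
  then show "eigenvalue A (lambda_max A)" "x \<bullet> (A *v x) \<le> lambda_max A * (x \<bullet> x)"
    using ev bound by auto
qed

section \<open>Positive definite matrices\<close>

lemma pos_def_nonneg: "pos_def H \<Longrightarrow> 0 \<le> x \<bullet> (H *v x)"
  unfolding pos_def_def by (cases "x = 0") (auto intro: less_imp_le)

lemma pos_def_matrix_inv:
  fixes H :: "real^'n^'n"
  assumes "pos_def H"
  shows "H ** matrix_inv H = mat 1" and "matrix_inv H ** H = mat 1"
    and "transpose (matrix_inv H) = matrix_inv H"
proof -
  have "\<forall>x. H *v x = 0 \<longrightarrow> x = 0" using assms by (metis inner_zero_right less_irrefl pos_def_def)
  then have "invertible H"
    by (simp add: invertible_left_inverse matrix_left_invertible_ker)
  then have *: "H ** matrix_inv H = mat 1 \<and> matrix_inv H ** H = mat 1"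
    unfolding invertible_def matrix_inv_def by (rule someI_ex)
  then show r: "H ** matrix_inv H = mat 1" and "matrix_inv H ** H = mat 1" by auto
  have "transpose (matrix_inv H) ** H = mat 1"
    by (metis assms matrix_transpose_mul pos_def_def r transpose_mat)
  then show "transpose (matrix_inv H) = matrix_inv H"
    by (metis matrix_mul_assoc matrix_mul_lid matrix_mul_rid r)
qed

lemma obj_expand:
  fixes H :: "real^'n^'n"
  assumes "transpose H = H"
  shows "obj H a (y + e) = obj H a y + obj_grad H a y \<bullet> e + 1/2 * (e \<bullet> (H *v e))"
  using symmetric_inner[OF assms, of y e]
  by (simp add: obj_def obj_grad_def matrix_vector_right_distrib inner_add_left inner_add_right
      inner_diff_left inner_commute algebra_simps)

section \<open>One sweep\<close>

lemma fold_coord_step_notin: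
  "i \<notin> set is \<Longrightarrow> fold (coord_step H a r) is x $ i = x $ i"
  by (induction "is" arbitrary: x) (auto simp: coord_step_def)

text \<open>Row \<open>i\<close> of \<open>T\<close> sees only coordinates updated before
  \<open>i\<close>, which links \<open>T\<close> to the intermediate iterates.\<close>

lemma strict_lower_mult:
  "(strict_lower H *v d) $ i = (H *v (\<chi> j. if j < i then d $ j else 0)) $ i"
  by (auto simp: strict_lower_def matrix_vector_mult_def intro: sum.cong)

lemma sweep_component:
  fixes H :: "real ^ 'n::{finite,linorder} ^ 'n::{finite,linorder}"
    and a r x :: "real ^ 'n::{finite,linorder}"
  defines "y \<equiv> sweep H a r x"
  shows "y $ i = min (r $ i) (max 0 (x $ i - (obj_grad H a x + strict_lower H *v (y - x)) $ i))"
proof -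
  let ?F = "fold (coord_step H a r)"
  obtain l1 l2 where l: "sorted_list_of_set (UNIV :: 'n set) = l1 @ i # l2"
    by (metis UNIV_I finite set_sorted_list_of_set split_list)
  have srt: "sorted_wrt (<) (l1 @ i # l2)"
    using strict_sorted_list_of_set[of "UNIV :: 'n set"] l by simp
  have "set (l1 @ i # l2) = UNIV" using l by (metis finite set_sorted_list_of_set)
  then have all: "j \<in> set l1 \<or> j = i \<or> j \<in> set l2" for j by auto
  have less: "\<forall>j\<in>set l1. j < i" "\<forall>j\<in>set l2. i < j"
    using srt by (simp_all add: sorted_wrt_append)
  have l1: "j \<in> set l1 \<longleftrightarrow> j < i" and l2: "j \<in> set l2 \<longleftrightarrow> i < j" for j
    using all[of j] less by (metis order_less_asym order_less_irrefl)+
  \<comment> \<open>The iterate just before step \<open>i\<close>: final values below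
    \<open>i\<close>, initial values from \<open>i\<close> on.\<close>
  define m where "m = ?F l1 x"
  have y: "y = ?F l2 (coord_step H a r i m)"
    by (simp add: y_def sweep_def l m_def)
  have "m $ j = (if j < i then y $ j else x $ j)" for j
  proof (cases "j < i")
    case True
    then have "y $ j = m $ j"
      unfolding y by (subst fold_coord_step_notin) (auto simp: l2 coord_step_def)
    then show ?thesis using True by simp
  next
    case False
    then show ?thesis unfolding m_def by (simp add: fold_coord_step_notin l1)
  qed
  then have m: "m = x + (\<chi> j. if j < i then (y - x) $ j else 0)"
    by (simp add: vec_eq_iff)
  have "y $ i = coord_step H a r i m $ i"
    unfolding y by (subst fold_coord_step_notin) (auto simp: l2)
  also have "\<dots> = min (r $ i) (max 0 (m $ i - obj_grad H a m $ i))"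
    by (simp add: coord_step_def)
  also have "m $ i = x $ i" by (simp add: m)
  also have "obj_grad H a m $ i = (obj_grad H a x + strict_lower H *v (y - x)) $ i"
    by (simp add: obj_grad_def strict_lower_mult m matrix_vector_right_distrib)
  finally show ?thesis .
qed

text \<open>The recursion of \<open>sweep_component\<close> is triangular, hence determines the sweep.\<close>

lemma sweep_eqI:
  fixes H :: "real ^ 'n::{finite,linorder} ^ 'n::{finite,linorder}"
  assumes y: "\<And>i. y $ i = min (r $ i) (max 0 (x $ i - (obj_grad H a x + strict_lower H *v (y - x)) $ i))"
  shows "sweep H a r x = y"
proof -
  have "sweep H a r x $ i = y $ i" for i
  proof (induction "card {j. j < i}" arbitrary: i rule: less_induct)
    case less
    have "sweep H a r x $ j = y $ j" if "j < i" for j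
      using that by (intro less psubset_card_mono) auto
    then have "(\<chi> j. if j < i then (sweep H a r x - x) $ j else 0) = (\<chi> j. if j < i then (y - x) $ j else 0)"
      by (simp add: vec_eq_iff)
    then have "(strict_lower H *v (sweep H a r x - x)) $ i = (strict_lower H *v (y - x)) $ i"
      unfolding strict_lower_mult by simp
    then show ?case
      by (subst sweep_component, subst y) simp
  qed
  then show ?thesis by (simp add: vec_eq_iff)
qed

text \<open>Symmetry and the unit diagonal give \<open>H = I + T + T^T\<close>. Here and below
  \<open>d v* strict_lower H\<close> stands for \<open>T^T d\<close>.\<close>

lemma strict_lower_decomp:
  fixes H :: "real ^ 'n::{finite,linorder} ^ 'n::{finite,linorder}"
  assumes "transpose H = H" and "\<And>i. H $ i $ i = 1"
  shows "H *v d = d + strict_lower H *v d + d v* strict_lower H"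
proof -
  have "H $ i $ j = H $ j $ i" for i j
    using arg_cong[OF assms(1), of "\<lambda>M. M $ j $ i"] by (simp add: transpose_def)
  then have "H = mat 1 + strict_lower H + transpose (strict_lower H)"
    using assms(2) by (auto simp: vec_eq_iff mat_def strict_lower_def transpose_def)
  then have "H *v d = (mat 1 + strict_lower H + transpose (strict_lower H)) *v d" by simp
  then show ?thesis by (simp add: matrix_vector_mult_add_rdistrib)
qed

text \<open>Rewrites the point that the sweep clips as \<open>y - q\<close>, so that
  \<open>y\<close> becomes the projection of \<open>y - q\<close> onto the box.\<close>

lemma sweep_residual_eq:
  fixes H :: "real ^ 'n::{finite,linorder} ^ 'n::{finite,linorder}"
  assumes "transpose H = H" and "\<And>i. H $ i $ i = 1"
  shows "x - (obj_grad H a x + strict_lower H *v (y - x))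
       = y - (obj_grad H a y - (y - x) v* strict_lower H)"
  using strict_lower_decomp[OF assms, of "y - x"]
  by (simp add: obj_grad_def algebra_simps)

lemma sweep_variational:
  fixes H :: "real ^ 'n::{finite,linorder} ^ 'n::{finite,linorder}"
    and a r x :: "real ^ 'n::{finite,linorder}"
  assumes "transpose H = H" and "\<And>i. H $ i $ i = 1" and z: "z \<in> box_dom r"
  defines "y \<equiv> sweep H a r x"
  shows "0 \<le> (obj_grad H a y - (y - x) v* strict_lower H) \<bullet> (z - y)"
proof -
  let ?q = "obj_grad H a y - (y - x) v* strict_lower H"
  \<comment> \<open>Clipping fixes \<open>y $ i\<close> only if \<open>?q $ i > 0\<close> forces the
    lower bound and \<open>?q $ i < 0\<close> the upper one.\<close>
  have "0 \<le> ?q $ i * (z - y) $ i" for i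
  proof -
    have "y $ i = min (r $ i) (max 0 ((y - ?q) $ i))"
      unfolding sweep_residual_eq[OF assms(1,2), symmetric] y_def
      by (subst sweep_component) simp
    moreover have "0 \<le> z $ i" "z $ i \<le> r $ i" using z by (auto simp: mem_box_cart)
    ultimately show ?thesis
      by (auto simp: min_def max_def zero_le_mult_iff split: if_splits)
  qed
  then show ?thesis by (simp add: inner_vec_def sum_nonneg)
qed

text \<open>Half of \<open>d \<bullet> (H *v d)\<close> is \<open>d \<bullet> d / 2\<close> plus
  \<open>(T^T d) \<bullet> d\<close>; the latter turns the gradient at \<open>y\<close> into
  \<open>q\<close>. No relation between \<open>x\<close> and \<open>y\<close> is assumed.\<close>

lemma obj_sweep_diff:
  fixes H :: "real ^ 'n::{finite,linorder} ^ 'n::{finite,linorder}"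
  assumes "transpose H = H" and "\<And>i. H $ i $ i = 1"
  shows "obj H a x - obj H a y
       = 1/2 * ((y - x) \<bullet> (y - x)) + (obj_grad H a y - (y - x) v* strict_lower H) \<bullet> (x - y)"
proof -
  define d where "d = y - x"
  have x: "y - d = x" by (simp add: d_def)
  have "d \<bullet> (H *v d) = d \<bullet> d + 2 * ((d v* strict_lower H) \<bullet> d)"
    using dot_lmul_matrix[of d "strict_lower H" d]
    by (simp add: strict_lower_decomp[OF assms] inner_add_right inner_commute)
  moreover have "(- d) \<bullet> (H *v (- d)) = d \<bullet> (H *v d)"
    using matrix_vector_mult_scaleR[of H "-1" d] by simp
  moreover have "x - y = - d" by (simp add: d_def)
  ultimately show ?thesis
    using obj_expand[OF assms(1), of a y "- d"]
    by (simp add: x d_def[symmetric] inner_diff_left)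
qed

section \<open>Congruences \<open>T K T^T\<close> and completing the square\<close>

lemma inner_congruence:
  fixes T K :: "real^'n^'n"
  shows "d \<bullet> ((T ** K ** transpose T) *v d) = (d v* T) \<bullet> (K *v (d v* T))"
  by (simp add: matrix_vector_mul_assoc[symmetric] dot_lmul_matrix)

lemma transpose_congruence:
  fixes T K :: "real^'n^'n"
  assumes "transpose K = K"
  shows "transpose (T ** K ** transpose T) = T ** K ** transpose T"
  by (simp add: assms matrix_transpose_mul matrix_mul_assoc)

text \<open>The right side minus the left is half the form of \<open>H\<close> at
  \<open>e + w\<close>, where \<open>w\<close> is \<open>matrix_inv H *v s\<close>.\<close>

lemma complete_square_matrix_inv:
  fixes H :: "real^'n^'n"
  assumes "pos_def H"
  shows "- (s \<bullet> e) - 1/2 * (e \<bullet> (H *v e)) \<le> 1/2 * (s \<bullet> (matrix_inv H *v s))"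
proof -
  define w where "w = matrix_inv H *v s"
  have "H *v w = s" by (simp add: w_def matrix_vector_mul_assoc pos_def_matrix_inv[OF assms])
  moreover have "0 \<le> (e + w) \<bullet> (H *v (e + w))" by (rule pos_def_nonneg[OF assms])
  moreover have "w \<bullet> (H *v e) = (H *v w) \<bullet> e"
    using assms symmetric_inner by (auto simp: pos_def_def)
  ultimately show ?thesis
    by (simp add: w_def[symmetric] matrix_vector_right_distrib inner_add_left inner_add_right inner_commute)
qed

lemma lambda_max_congruence_nonneg:
  fixes H T :: "real^'n^'n"
  assumes H: "pos_def H"
  shows "0 \<le> lambda_max (T ** matrix_inv H ** transpose T)"
proof -
  let ?M = "T ** matrix_inv H ** transpose T"
  obtain v where v: "v \<noteq> 0" "?M *v v = lambda_max ?M *\<^sub>R v"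
    using lambda_max_symmetric(1)[OF transpose_congruence[OF pos_def_matrix_inv(3)[OF H]], of T]
    by (auto simp: eigenvalue_def)
  have "0 \<le> v \<bullet> (?M *v v)"
    unfolding inner_congruence
    using complete_square_matrix_inv[OF H, of "v v* T" 0] by simp
  moreover have "v \<bullet> v > 0" using v by simp
  ultimately show ?thesis using v(2) by (simp add: zero_le_mult_iff)
qed

section \<open>Minimizers over the box\<close>

lemma minimizers_iff:
  "z \<in> minimizers H a r \<longleftrightarrow> z \<in> box_dom r \<and> (\<forall>y\<in>box_dom r. obj H a z \<le> obj H a y)"
  by (auto simp: minimizers_def is_arg_min_def not_less)

lemma obj_min_eq:
  assumes "z \<in> minimizers H a r"
  shows "obj_min H a r = obj H a z"
  unfolding obj_min_def using assms by (intro cInf_eq_minimum) (auto simp: minimizers_iff)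

lemma minimizers_nonempty:
  fixes H :: "real^'n^'n"
  assumes "\<And>i. r $ i > 0"
  shows "minimizers H a r \<noteq> {}"
proof -
  have "0 \<in> box_dom r" using assms by (auto simp: mem_box_cart less_imp_le)
  moreover have "continuous_on (box_dom r) (obj H a)"
    unfolding obj_def
    by (intro continuous_intros linear_continuous_on matrix_vector_mul_bounded_linear)
  ultimately obtain z where "z \<in> box_dom r" "\<forall>y\<in>box_dom r. obj H a z \<le> obj H a y"
    using continuous_attains_inf[of "box_dom r" "obj H a"] compact_cbox by blast
  then have "z \<in> minimizers H a r" by (simp add: minimizers_iff)
  then show ?thesis by blast
qed

lemma gap_pos:
  fixes H :: "real^'n^'n"
  assumes "\<And>i. r $ i > 0" and "x \<in> box_dom r - minimizers H a r"
  shows "gap H a r x > 0"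
proof -
  obtain z where z: "z \<in> minimizers H a r" using minimizers_nonempty[OF assms(1)] by blast
  then show ?thesis
    using assms(2) obj_min_eq[OF z] by (fastforce simp: gap_def minimizers_iff not_le)
qed

text \<open>A constant objective would take equal values at 0, \<open>r / 2\<close> and
  \<open>r\<close>, contradicting strict convexity. The supremum in \<open>contraction\<close> is
  thus over a nonempty set.\<close>

lemma nonminimizers_nonempty:
  fixes H :: "real^'n^'n"
  assumes H: "pos_def H" and r: "\<And>i. r $ i > 0"
  shows "box_dom r - minimizers H a r \<noteq> {}"
proof
  assume "box_dom r - minimizers H a r = {}"
  then have const: "obj H a x = obj H a y" if "x \<in> box_dom r" "y \<in> box_dom r" for x y
    using that by (auto simp: minimizers_iff intro!: antisym)
  have mem: "0 \<in> box_dom r" "r \<in> box_dom r" "(1/2) *\<^sub>R r \<in> box_dom r"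
    using r by (auto simp: mem_box_cart less_imp_le)
  have "r \<noteq> 0" using r by (metis less_irrefl zero_index)
  then have "r \<bullet> (H *v r) > 0" using H by (auto simp: pos_def_def)
  then show False
    using const[OF mem(1,2)] const[OF mem(1,3)]
    by (simp add: obj_def matrix_vector_mult_scaleR)
qed

lemma interior_minimizer_grad:
  fixes H :: "real^'n^'n"
  assumes sym: "transpose H = H" and z: "z \<in> minimizers H a r" "z \<in> interior (box_dom r)"
  shows "obj_grad H a z = 0"
proof -
  define u where "u = obj_grad H a z"
  obtain e where e: "e > 0" "ball z e \<subseteq> box_dom r" using z(2) unfolding mem_interior by blast
  have "u \<bullet> u \<le> 0"
  \<comment> \<open>A gradient step of this length stays in the ball; the \<open>+ 1\<close> avoids
    division by zero.\<close>
  proof (rule linear_coeff_nonpos[of "e / (norm u + 1)" _ "1/2 * (u \<bullet> (H *v u))"])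
    show "e / (norm u + 1) > 0" using e by (simp add: add_nonneg_pos)
    fix t :: real
    assume t: "0 < t" "t < e / (norm u + 1)"
    have "t * norm u \<le> t * (norm u + 1)" using t by simp
    also have "\<dots> < e" using t by (simp add: pos_less_divide_eq add_nonneg_pos)
    finally have "z + (- t) *\<^sub>R u \<in> box_dom r"
      using t e(2) by (intro subsetD[OF e(2)]) (simp add: dist_norm)
    then have "obj H a z \<le> obj H a (z + (- t) *\<^sub>R u)" using z(1) by (auto simp: minimizers_iff)
    then show "t * (u \<bullet> u) \<le> t\<^sup>2 * (1/2 * (u \<bullet> (H *v u)))"
      unfolding obj_expand[OF sym] matrix_vector_mult_scaleR
      by (simp add: u_def power2_eq_square)
  qed
  then show ?thesis by (metis antisym inner_eq_zero_iff inner_ge_zero u_def)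
qed

section \<open>The contraction factor\<close>

text \<open>The form without quotients also covers minimizers \<open>x\<close>, where the gap
  vanishes.\<close>

lemma sweep_contraction:
  fixes H :: "real ^ 'n::{finite,linorder} ^ 'n::{finite,linorder}"
  assumes H: "pos_def H" and diag: "\<And>i. H $ i $ i = 1" and r: "\<And>i. r $ i > 0"
    and A0: "A0 = lambda_max (strict_lower H ** matrix_inv H ** transpose (strict_lower H))"
    and x: "x \<in> box_dom r"
  shows "gap H a r (sweep H a r x) \<le> A0 * (gap H a r x - gap H a r (sweep H a r x))"
proof -
  let ?T = "strict_lower H"
  have sym: "transpose H = H" using H by (simp add: pos_def_def)
  obtain z where z: "z \<in> minimizers H a r" using minimizers_nonempty[OF r] by blast
  define y where "y = sweep H a r x"
  define d where "d = y - x"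
  define q where "q = obj_grad H a y - d v* ?T"
  have var: "0 \<le> q \<bullet> (w - y)" if "w \<in> box_dom r" for w
    using sweep_variational[OF sym diag that, of a x] by (simp add: q_def d_def y_def)
  have "obj H a x - obj H a y \<ge> 1/2 * (d \<bullet> d)"
    using obj_sweep_diff[OF sym diag, of a x y] var[OF x] by (simp add: q_def d_def)
  then have decrease: "d \<bullet> d \<le> 2 * (gap H a r x - gap H a r y)" by (simp add: gap_def)
  note mat = pos_def_matrix_inv[OF H]
  note top = lambda_max_symmetric[OF transpose_congruence[OF mat(3), of ?T], folded A0]
  have quad: "d \<bullet> ((?T ** matrix_inv H ** transpose ?T) *v d) \<le> A0 * (d \<bullet> d)" by (rule top(2))
  have zbox: "z \<in> box_dom r" using z by (simp add: minimizers_iff)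
  have "gap H a r y = - (obj_grad H a y \<bullet> (z - y)) - 1/2 * ((z - y) \<bullet> (H *v (z - y)))"
    using obj_expand[OF sym, of a y "z - y"] by (simp add: gap_def obj_min_eq[OF z])
  \<comment> \<open>The variational inequality at the minimizer \<open>z\<close> trades the gradient
    at \<open>y\<close> for \<open>T^T d\<close>.\<close>
  also have "\<dots> \<le> - ((d v* ?T) \<bullet> (z - y)) - 1/2 * ((z - y) \<bullet> (H *v (z - y)))"
    using var[OF zbox] by (simp add: q_def inner_diff_left)
  also have "\<dots> \<le> 1/2 * (d \<bullet> ((?T ** matrix_inv H ** transpose ?T) *v d))"
    unfolding inner_congruence by (rule complete_square_matrix_inv[OF H])
  finally have gap_y: "gap H a r y \<le> 1/2 * (A0 * (d \<bullet> d))" using quad by simp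
  have "A0 \<ge> 0"
    unfolding A0 by (rule lambda_max_congruence_nonneg[OF H])
  then have "A0 * (d \<bullet> d) \<le> A0 * (2 * (gap H a r x - gap H a r y))"
    by (intro mult_left_mono decrease)
  then show ?thesis using gap_y by (simp add: y_def[symmetric] right_diff_distrib)
qed

lemma scaleR_small_obtain:
  fixes u v :: "'a::real_normed_vector"
  assumes "e > 0"
  obtains t :: real where "t > 0" "norm (t *\<^sub>R u) < e" "norm (t *\<^sub>R v) < e"
proof
  define s where "s = e / (norm u + norm v + 1)"
  have pos: "norm u + norm v + 1 > 0" by (simp add: add_nonneg_pos)
  show s: "s > 0" using assms pos by (simp add: s_def)
  have eq: "s * (norm u + norm v + 1) = e" using pos by (simp add: s_def)
  have "s * norm u < s * (norm u + norm v + 1)" "s * norm v < s * (norm u + norm v + 1)"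
    using s by (auto intro!: mult_strict_left_mono simp: add_nonneg_pos add_pos_nonneg)
  then show "norm (s *\<^sub>R u) < e" "norm (s *\<^sub>R v) < e" using s eq by auto
qed

lemma sweep_contraction_attained:
  fixes H :: "real ^ 'n::{finite,linorder} ^ 'n::{finite,linorder}"
  assumes H: "pos_def H" and diag: "\<And>i. H $ i $ i = 1" and r: "\<And>i. r $ i > 0"
    and A0: "A0 = lambda_max (strict_lower H ** matrix_inv H ** transpose (strict_lower H))"
    and xs: "xs \<in> minimizers H a r" "xs \<in> interior (box_dom r)"
  obtains x where "x \<in> box_dom r - minimizers H a r"
    and "gap H a r (sweep H a r x) = A0 * (gap H a r x - gap H a r (sweep H a r x))"
proof -
  let ?T = "strict_lower H"
  have sym: "transpose H = H" using H by (simp add: pos_def_def)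
  note mat = pos_def_matrix_inv[OF H]
  obtain v where v: "v \<noteq> 0" "(?T ** matrix_inv H ** transpose ?T) *v v = A0 *\<^sub>R v"
    using lambda_max_symmetric(1)[OF transpose_congruence[OF mat(3), of ?T], folded A0]
    by (auto simp: eigenvalue_def)
  obtain e where e: "e > 0" "ball xs e \<subseteq> box_dom r" using xs(2) unfolding mem_interior by blast
  \<comment> \<open>This choice gives \<open>H *v w = T^T v\<close>, so the gradient at
    \<open>xs + t *\<^sub>R w\<close> equals \<open>T^T d\<close> and \<open>q\<close>
    vanishes.\<close>
  define w where "w = matrix_inv H *v (v v* ?T)"
  \<comment> \<open>One scale keeps both \<open>y\<close> and \<open>x\<close> inside the ball
    around \<open>xs\<close>.\<close>
  obtain t where t: "t > 0" "norm (t *\<^sub>R w) < e" "norm (t *\<^sub>R (w - v)) < e"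
    using scaleR_small_obtain[OF e(1)] by blast
  define d where "d = t *\<^sub>R v"
  define y where "y = xs + t *\<^sub>R w"
  define x where "x = y - d"
  have d: "d = y - x" by (simp add: x_def)
  have ybox: "y \<in> box_dom r"
    using t by (intro subsetD[OF e(2)]) (simp add: y_def dist_norm)
  have "x = xs + t *\<^sub>R (w - v)" by (simp add: x_def y_def d_def algebra_simps)
  then have xbox: "x \<in> box_dom r"
    using t by (intro subsetD[OF e(2)]) (simp add: dist_norm del: scaleR_right_diff_distrib)
  have Hw: "H *v w = v v* ?T" by (simp add: w_def matrix_vector_mul_assoc mat)
  have dT: "d v* ?T = t *\<^sub>R (v v* ?T)"
    by (metis d_def matrix_vector_mult_scaleR transpose_matrix_vector)
  have grad: "obj_grad H a xs = 0" by (rule interior_minimizer_grad[OF sym xs])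
  then have q: "obj_grad H a y - (y - x) v* ?T = 0"
    unfolding d[symmetric] dT
    by (simp add: obj_grad_def y_def matrix_vector_right_distrib matrix_vector_mult_scaleR Hw)
  have sw: "sweep H a r x = y"
  proof (rule sweep_eqI)
    fix i
    \<comment> \<open>As \<open>q = 0\<close>, the unclipped point is \<open>y\<close> itself; it
      lies in the box, so clipping leaves it alone.\<close>
    have "x - (obj_grad H a x + ?T *v (y - x)) = y"
      unfolding sweep_residual_eq[OF sym diag] q by simp
    then have "x $ i - (obj_grad H a x + ?T *v (y - x)) $ i = y $ i"
      by (metis vector_minus_component)
    then show "y $ i = min (r $ i) (max 0 (x $ i - (obj_grad H a x + ?T *v (y - x)) $ i))"
      using ybox by (simp add: mem_box_cart)
  qed
  have decrease: "gap H a r x - gap H a r y = 1/2 * (d \<bullet> d)"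
    using obj_sweep_diff[OF sym diag, of a x y] unfolding q by (simp add: gap_def d)
  have "gap H a r y = 1/2 * ((t *\<^sub>R w) \<bullet> (H *v (t *\<^sub>R w)))"
    using obj_expand[OF sym, of a xs "t *\<^sub>R w"] grad
    by (simp add: gap_def obj_min_eq[OF xs(1)] y_def)
  also have "\<dots> = 1/2 * t\<^sup>2 * ((v v* ?T) \<bullet> w)"
    by (simp add: matrix_vector_mult_scaleR Hw power2_eq_square inner_commute)
  \<comment> \<open>The eigenvector equation makes the quadratic bound an equality.\<close>
  also have "(v v* ?T) \<bullet> w = A0 * (v \<bullet> v)"
    using v(2) inner_congruence[of v ?T "matrix_inv H"] by (simp add: w_def)
  finally have gap_y: "gap H a r y = A0 * (1/2 * (d \<bullet> d))"
    by (simp add: d_def power2_eq_square)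
  have "d \<bullet> d > 0" using v t by (simp add: d_def)
  moreover have "obj H a xs \<le> obj H a y" using xs(1) ybox by (simp add: minimizers_iff)
  ultimately have "obj H a xs < obj H a x"
    using decrease unfolding gap_def by linarith
  then have "x \<notin> minimizers H a r"
    using xs(1) by (auto simp: minimizers_iff not_le)
  then show ?thesis
    using that[of x] xbox gap_y decrease sw by simp
qed

theorem theorem2:
  fixes H :: "real ^ 'n::{finite,linorder} ^ 'n::{finite,linorder}"
    and a r :: "real ^ 'n::{finite,linorder}"
    and A0 :: real
  assumes "pos_def H"
    and "\<And>i. H $ i $ i = 1"
    and "\<And>i. r $ i > 0"
    and "A0 = lambda_max (strict_lower H ** matrix_inv H ** transpose (strict_lower H))"
  shows "contraction H a r \<le> A0 / (1 + A0)
    \<and> (\<forall>xs. xs \<in> minimizers H a r \<and> xs \<in> interior (box_dom r) \<longrightarrow>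
           contraction H a r = A0 / (1 + A0))"
proof -
  let ?N = "box_dom r - minimizers H a r"
  let ?R = "\<lambda>x. gap H a r (sweep H a r x) / gap H a r x"
  have pos: "1 + A0 > 0"
    using lambda_max_congruence_nonneg[OF assms(1)] assms(4) by (simp add: add_pos_nonneg)
  have le: "?R x \<le> A0 / (1 + A0)" if "x \<in> ?N" for x
  proof -
    have "(1 + A0) * gap H a r (sweep H a r x) \<le> A0 * gap H a r x"
      using sweep_contraction[OF assms, of x a] that by (simp add: algebra_simps)
    then show ?thesis
      using gap_pos[OF assms(3) that] pos by (simp add: field_simps)
  qed
  have upper: "contraction H a r \<le> A0 / (1 + A0)"
    unfolding contraction_def
    using nonminimizers_nonempty[OF assms(1,3)] le by (rule cSUP_least)
  moreover have "contraction H a r = A0 / (1 + A0)"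
    if xs: "xs \<in> minimizers H a r" "xs \<in> interior (box_dom r)" for xs
  proof -
    obtain x where x: "x \<in> ?N"
      "gap H a r (sweep H a r x) = A0 * (gap H a r x - gap H a r (sweep H a r x))"
      using sweep_contraction_attained[OF assms xs] by blast
    have "?R x = A0 / (1 + A0)"
      using x(2) gap_pos[OF assms(3) x(1)] pos by (simp add: field_simps)
    \<comment> \<open>A real supremum dominates its members only if they are bounded above, which
      \<open>le\<close> supplies.\<close>
    moreover have "?R x \<le> contraction H a r"
      unfolding contraction_def using le x(1) by (intro cSUP_upper) (auto simp: bdd_above_def)
    ultimately show ?thesis using upper by simp
  qed
  ultimately show ?thesis by blast
qed

end
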